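(* Let $G$ be a finite Abelian group, written multiplicatively, with $\ell$ elements $g_0,\dots,g_{\ell-1}$ and unit element $1$. For a probability distribution $p$ on $G$ (i.e. $p(g_a)\ge 0$ for all $a$ and $\sum_{a=0}^{\ell-1}p(g_a)=1$), let ${\cal P}={\cal P}(p)$ be the $\ell\times\ell$ matrix with elements ${\cal P}_{ab}=p(g_a^{-1}g_b)$, $a,b\in\{0,\dots,\ell-1\}$ (in particular all diagonal elements equal $p(1)$). Then: (1) For each $r\in\{0,\dots,\ell-1\}$, if $p(g_r)=1$ (and $p(g_s)=0$ for all $s\ne r$), then ${\cal P}(p)$ is a permutation matrix, which is denoted $M(r)$. (2) The $\ell$ permutation matrices $M(0),\dots,M(\ell-1)$ form a subgroup of the symmetric group of all permutations of $\{0,\dots,\ell-1\}$ (identified with the group of $\ell\times\ell$ permutation matrices under matrix multiplication), and this subgroup is isomorphic to $G$. (3) The matrices ${\cal P}(p)$, with $p$ ranging over all probability distributions on $G$, form the Birkhoff subpolytope ${\cal B}(G)$; that is, $\{{\cal P}(p)\,:\,p \text{ a probability distribution on } G\}={\cal B}(G)$.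
   Context: A permutation matrix is a square matrix of the form $M_\pi(a,b)=\delta(\pi(a),b)$, where $\pi$ is a permutation of $\{0,\dots,\ell-1\}$ and $\delta$ is the Kronecker delta; each row and each column has exactly one element equal to $1$ and all others equal to $0$. For a subgroup ${\cal S}_1$ of the symmetric group ${\cal S}$ of all permutations of $\{0,\dots,\ell-1\}$, the Birkhoff subpolytope ${\cal B}({\cal S}_1)$ is the set of all doubly stochastic matrices that are convex combinations of the permutation matrices of ${\cal S}_1$: all $\sum_{\pi\in{\cal S}_1}\lambda(\pi)M_\pi$ with $\lambda(\pi)\ge 0$ and $\sum_{\pi\in{\cal S}_1}\lambda(\pi)=1$. For the group $G$, ${\cal B}(G)$ denotes the Birkhoff subpolytope ${\cal B}({\cal S}_1)$ where ${\cal S}_1\cong G$ is the subgroup of permutations whose permutation matrices are $M(0),\dots,M(\ell-1)$ as in part (2). *)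

theory Defs
  imports "Jordan_Normal_Form.Matrix" "HOL-Algebra.Bij" "HOL-Algebra.Coset"
begin

(* The symmetric group of {0,...,l-1} is BijGroup {0..<l}: its elements are the extensional
   bijections of {0..<l}, multiplied by composition. *)

definition perm_matrix :: "nat \<Rightarrow> (nat \<Rightarrow> nat) \<Rightarrow> real mat" where
  "perm_matrix l \<pi> = mat l l (\<lambda>(a, b). if \<pi> a = b then 1 else 0)"

definition perm_matrices :: "nat \<Rightarrow> real mat set" where
  "perm_matrices l = perm_matrix l ` Bij {0..<l}"

definition perm_matrix_group :: "nat \<Rightarrow> real mat monoid" where
  "perm_matrix_group l = \<lparr>carrier = perm_matrices l, mult = (*), one = 1\<^sub>m l\<rparr>"

definition doubly_stochastic :: "nat \<Rightarrow> real mat \<Rightarrow> bool" where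
  "doubly_stochastic l A \<longleftrightarrow>
     A \<in> carrier_mat l l \<and>
     (\<forall>a<l. \<forall>b<l. 0 \<le> A $$ (a, b)) \<and>
     (\<forall>a<l. (\<Sum>b=0..<l. A $$ (a, b)) = 1) \<and>
     (\<forall>b<l. (\<Sum>a=0..<l. A $$ (a, b)) = 1)"

(* The type of matrices of unspecified dimension has no zero, so the sum over permutations
   is taken entrywise. *)
definition birkhoff_subpolytope :: "nat \<Rightarrow> (nat \<Rightarrow> nat) set \<Rightarrow> real mat set" where
  "birkhoff_subpolytope l S =
     {A. doubly_stochastic l A \<and>
         (\<exists>c :: (nat \<Rightarrow> nat) \<Rightarrow> real.
            (\<forall>\<pi>\<in>S. 0 \<le> c \<pi>) \<and> (\<Sum>\<pi>\<in>S. c \<pi>) = 1 \<and>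
            A = mat l l (\<lambda>(a, b). \<Sum>\<pi>\<in>S. c \<pi> * perm_matrix l \<pi> $$ (a, b)))}"

definition prob_distribution_on :: "('a, 'b) monoid_scheme \<Rightarrow> ('a \<Rightarrow> real) \<Rightarrow> bool" where
  "prob_distribution_on G p \<longleftrightarrow> (\<forall>x\<in>carrier G. 0 \<le> p x) \<and> (\<Sum>x\<in>carrier G. p x) = 1"

(* In the following definitions g enumerates the elements g 0, ..., g (l - 1) of G. *)

definition group_matrix ::
  "('a, 'b) monoid_scheme \<Rightarrow> (nat \<Rightarrow> 'a) \<Rightarrow> nat \<Rightarrow> ('a \<Rightarrow> real) \<Rightarrow> real mat" where
  "group_matrix G g l p = mat l l (\<lambda>(a, b). p (inv\<^bsub>G\<^esub> (g a) \<otimes>\<^bsub>G\<^esub> g b))"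

definition point_matrix ::
  "('a, 'b) monoid_scheme \<Rightarrow> (nat \<Rightarrow> 'a) \<Rightarrow> nat \<Rightarrow> nat \<Rightarrow> real mat" where
  "point_matrix G g l r = group_matrix G g l (\<lambda>x. if x = g r then 1 else 0)"

definition point_perms ::
  "('a, 'b) monoid_scheme \<Rightarrow> (nat \<Rightarrow> 'a) \<Rightarrow> nat \<Rightarrow> (nat \<Rightarrow> nat) set" where
  "point_perms G g l =
     {\<pi> \<in> carrier (BijGroup {0..<l}). perm_matrix l \<pi> \<in> point_matrix G g l ` {0..<l}}"

(* The next lemmas make precise the identification of permutations with permutation matrices:
   perm_matrix is a bijection onto perm_matrices l that reverses products. *)

lemma perm_matrix_mult:
  assumes "\<pi> \<in> Bij {0..<l}" "\<sigma> \<in> Bij {0..<l}"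
  shows "perm_matrix l \<pi> * perm_matrix l \<sigma> = perm_matrix l (compose {0..<l} \<sigma> \<pi>)"
proof (rule eq_matI)
  fix a b assume "a < dim_row (perm_matrix l (compose {0..<l} \<sigma> \<pi>))"
    "b < dim_col (perm_matrix l (compose {0..<l} \<sigma> \<pi>))"
  then have ab: "a < l" "b < l" by (auto simp: perm_matrix_def)
  have pa: "\<pi> a < l" using assms(1) ab by (auto simp: Bij_def bij_betw_def)
  have "(perm_matrix l \<pi> * perm_matrix l \<sigma>) $$ (a, b) =
      (\<Sum>c = 0..<l. (if \<pi> a = c then 1 else 0) * (if \<sigma> c = b then 1 else 0))"
    using ab by (simp add: perm_matrix_def scalar_prod_def)
  also have "\<dots> = (\<Sum>c = 0..<l. if \<pi> a = c then (if \<sigma> c = b then 1 else 0) else 0)"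
    by (rule sum.cong) auto
  also have "\<dots> = (if \<sigma> (\<pi> a) = b then 1 else 0)" using pa by simp
  finally show "(perm_matrix l \<pi> * perm_matrix l \<sigma>) $$ (a, b) =
      perm_matrix l (compose {0..<l} \<sigma> \<pi>) $$ (a, b)"
    using ab by (simp add: perm_matrix_def compose_def)
qed (auto simp: perm_matrix_def)

lemma perm_matrix_bij: "bij_betw (perm_matrix l) (Bij {0..<l}) (perm_matrices l)"
proof -
  have "inj_on (perm_matrix l) (Bij {0..<l})"
  proof (rule inj_onI)
    fix \<pi> \<sigma> assume \<pi>: "\<pi> \<in> Bij {0..<l}" and \<sigma>: "\<sigma> \<in> Bij {0..<l}"
      and eq: "perm_matrix l \<pi> = perm_matrix l \<sigma>"
    have "\<pi> a = \<sigma> a" if "a \<in> {0..<l}" for a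
    proof -
      have s: "\<sigma> a < l" using \<sigma> that by (auto simp: Bij_def bij_betw_def)
      have "perm_matrix l \<pi> $$ (a, \<sigma> a) = perm_matrix l \<sigma> $$ (a, \<sigma> a)" by (simp add: eq)
      then show ?thesis using s that by (simp add: perm_matrix_def split: if_splits)
    qed
    then show "\<pi> = \<sigma>"
      using \<pi> \<sigma> by (intro extensionalityI[where A = "{0..<l}"]) (auto simp: Bij_def)
  qed
  then show ?thesis by (simp add: bij_betw_def perm_matrices_def)
qed

lemma perm_matrix_one: "perm_matrix l (\<lambda>a\<in>{0..<l}. a) = 1\<^sub>m l"
  by (rule eq_matI) (auto simp: perm_matrix_def)

lemma group_perm_matrix_group: "group (perm_matrix_group l)"
proof (rule groupI)
  fix A B assume "A \<in> carrier (perm_matrix_group l)" "B \<in> carrier (perm_matrix_group l)"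
  then obtain \<pi> \<sigma> where "\<pi> \<in> Bij {0..<l}" "\<sigma> \<in> Bij {0..<l}"
    and "A = perm_matrix l \<pi>" "B = perm_matrix l \<sigma>"
    by (auto simp: perm_matrix_group_def perm_matrices_def)
  then show "A \<otimes>\<^bsub>perm_matrix_group l\<^esub> B \<in> carrier (perm_matrix_group l)"
    using compose_Bij[of \<sigma> "{0..<l}" \<pi>]
    by (simp add: perm_matrix_group_def perm_matrices_def perm_matrix_mult)
next
  show "\<one>\<^bsub>perm_matrix_group l\<^esub> \<in> carrier (perm_matrix_group l)"
    using imageI[OF id_Bij[of "{0..<l}"], of "perm_matrix l"]
    by (simp add: perm_matrix_group_def perm_matrices_def perm_matrix_one)
next
  fix A B C assume "A \<in> carrier (perm_matrix_group l)" "B \<in> carrier (perm_matrix_group l)"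
    "C \<in> carrier (perm_matrix_group l)"
  then have "A \<in> carrier_mat l l" "B \<in> carrier_mat l l" "C \<in> carrier_mat l l"
    by (auto simp: perm_matrix_group_def perm_matrices_def perm_matrix_def)
  then show "A \<otimes>\<^bsub>perm_matrix_group l\<^esub> B \<otimes>\<^bsub>perm_matrix_group l\<^esub> C =
      A \<otimes>\<^bsub>perm_matrix_group l\<^esub> (B \<otimes>\<^bsub>perm_matrix_group l\<^esub> C)"
    by (simp add: perm_matrix_group_def)
next
  fix A assume "A \<in> carrier (perm_matrix_group l)"
  then show "\<one>\<^bsub>perm_matrix_group l\<^esub> \<otimes>\<^bsub>perm_matrix_group l\<^esub> A = A"
    by (auto simp: perm_matrix_group_def perm_matrices_def perm_matrix_def)
next
  fix A assume "A \<in> carrier (perm_matrix_group l)"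
  then obtain \<pi> where \<pi>: "\<pi> \<in> Bij {0..<l}" "A = perm_matrix l \<pi>"
    by (auto simp: perm_matrix_group_def perm_matrices_def)
  let ?\<sigma> = "\<lambda>a\<in>{0..<l}. inv_into {0..<l} \<pi> a"
  have \<sigma>: "?\<sigma> \<in> Bij {0..<l}" by (rule restrict_inv_into_Bij[OF \<pi>(1)])
  have "compose {0..<l} \<pi> ?\<sigma> = (\<lambda>a\<in>{0..<l}. a)"
  proof
    fix a
    show "compose {0..<l} \<pi> ?\<sigma> a = (\<lambda>a\<in>{0..<l}. a) a"
    proof (cases "a \<in> {0..<l}")
      case True
      have "\<pi> ` {0..<l} = {0..<l}" using \<pi>(1) unfolding Bij_def bij_betw_def by blast
      then have "a \<in> \<pi> ` {0..<l}" using True by (rule ssubst)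
      then have "\<pi> (inv_into {0..<l} \<pi> a) = a" by (rule f_inv_into_f)
      with True show ?thesis by (simp only: compose_eq restrict_apply' )
    qed (simp add: compose_def)
  qed
  then have "perm_matrix l ?\<sigma> * A = 1\<^sub>m l"
    unfolding \<pi>(2) perm_matrix_mult[OF \<sigma> \<pi>(1)] by (simp only: perm_matrix_one)
  moreover have "perm_matrix l ?\<sigma> \<in> perm_matrices l"
    unfolding perm_matrices_def using \<sigma> by (rule imageI)
  ultimately show "\<exists>B\<in>carrier (perm_matrix_group l).
      B \<otimes>\<^bsub>perm_matrix_group l\<^esub> A = \<one>\<^bsub>perm_matrix_group l\<^esub>"
    unfolding perm_matrix_group_def monoid.simps partial_object.simps by (rule bexI)
qed

end

(* The point mass at x gives the matrix of the translation y \<mapsto> y x, viewed on indices through g.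
   Translations form the regular representation of G, which is an injective homomorphism, so both
   the permutations and their matrices form isomorphic copies of G. A general P(p) is the
   combination of the translation matrices with coefficients p(x). *)
theory Submission
  imports Defs
begin

text \<open>The target stays arbitrary because the lemma serves twice, once for permutations and
  once for matrices. Corestricted to its image, \<open>h\<close> becomes a bijection.\<close>

lemma (in group) inj_hom_image_subgroup_iso:
  assumes "group H" "h \<in> hom G H" "inj_on h (carrier G)"
  shows "subgroup (h ` carrier G) H" "H\<lparr>carrier := h ` carrier G\<rparr> \<cong> G"
proof -
  have h: "group_hom G H h"
    using assms is_group by (simp add: group_hom_def group_hom_axioms_def)
  show "subgroup (h ` carrier G) H" by (rule group_hom.img_is_subgroup[OF h])
  have "h \<in> iso G (H\<lparr>carrier := h ` carrier G\<rparr>)"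
    using assms(2,3) by (auto simp: iso_def hom_def bij_betw_def)
  then show "H\<lparr>carrier := h ` carrier G\<rparr> \<cong> G"
    by (rule iso_sym[OF is_isoI])
qed

locale enumerated_comm_group = comm_group G for G (structure) +
  fixes g :: "nat \<Rightarrow> 'a" and l :: nat
  assumes enum: "bij_betw g {0..<l} (carrier G)"
begin

definition index :: "'a \<Rightarrow> nat" where
  "index = inv_into {0..<l} g"

text \<open>Multiplication is on the right because entry (a, b) of a group matrix depends on the
  \<open>x\<close> with \<open>g a \<otimes> x = g b\<close>. The restriction makes the map
  extensional, as \<open>Bij\<close> demands.\<close>

definition translation_perm :: "'a \<Rightarrow> nat \<Rightarrow> nat" where
  "translation_perm x = (\<lambda>a\<in>{0..<l}. index (g a \<otimes> x))"

lemma finite_carrier: "finite (carrier G)"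
  using enum bij_betw_finite by blast

lemma enum_closed [simp]: "a < l \<Longrightarrow> g a \<in> carrier G"
  using enum by (auto simp: bij_betw_def)

lemma index_less [simp]: "x \<in> carrier G \<Longrightarrow> index x < l"
  unfolding index_def using bij_betw_apply[OF bij_betw_inv_into[OF enum]] by simp

lemma enum_index [simp]: "x \<in> carrier G \<Longrightarrow> g (index x) = x"
  unfolding index_def by (rule bij_betw_inv_into_right[OF enum])

lemma index_enum [simp]: "a < l \<Longrightarrow> index (g a) = a"
  unfolding index_def by (rule bij_betw_inv_into_left[OF enum]) simp

lemma index_eq_iff: "x \<in> carrier G \<Longrightarrow> b < l \<Longrightarrow> index x = b \<longleftrightarrow> x = g b"
  by auto

lemma translation_perm_Bij:
  assumes x: "x \<in> carrier G"
  shows "translation_perm x \<in> Bij {0..<l}"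
proof -
  have "bij_betw (translation_perm x) {0..<l} {0..<l}"
    using x
    by (intro bij_betw_byWitness[where f' = "translation_perm (inv x)"])
      (auto simp: translation_perm_def m_assoc)
  then show ?thesis by (simp add: Bij_def translation_perm_def)
qed

(* Right translations reverse products in general; this needs G commutative. *)
lemma translation_perm_mult:
  assumes "x \<in> carrier G" "y \<in> carrier G"
  shows "translation_perm (x \<otimes> y) = compose {0..<l} (translation_perm x) (translation_perm y)"
proof
  fix a
  show "translation_perm (x \<otimes> y) a = compose {0..<l} (translation_perm x) (translation_perm y) a"
    using assms m_comm[of x y] by (simp add: translation_perm_def compose_def m_assoc)
qed

lemma translation_perm_inj: "inj_on translation_perm (carrier G)"
proof (rule inj_onI)
  fix x y assume xy: "x \<in> carrier G" "y \<in> carrier G"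
    and "translation_perm x = translation_perm y"
  \<comment> \<open>A translation is determined by where it sends the unit: the index of the unit
    goes to the index of \<open>x\<close>.\<close>
  then have "translation_perm x (index \<one>) = translation_perm y (index \<one>)" by simp
  with xy have "index x = index y" by (simp add: translation_perm_def)
  with xy show "x = y" by (metis enum_index)
qed

lemma translation_perm_hom: "translation_perm \<in> hom G (BijGroup {0..<l})"
  by (rule homI)
    (simp_all add: BijGroup_def translation_perm_Bij translation_perm_mult)

text \<open>Both entries at (a, b) are 1 exactly when \<open>g a \<otimes> x = g b\<close>, which is
  solved by \<open>x = inv (g a) \<otimes> g b\<close>.\<close>

lemma perm_matrix_translation_perm:
  assumes x: "x \<in> carrier G"
  shows "perm_matrix l (translation_perm x) = group_matrix G g l (\<lambda>y. if y = x then 1 else 0)"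
proof (rule eq_matI)
  fix a b
  assume "a < dim_row (group_matrix G g l (\<lambda>y. if y = x then 1 else 0))"
    and "b < dim_col (group_matrix G g l (\<lambda>y. if y = x then 1 else 0))"
  then have ab: "a < l" "b < l" by (simp_all add: group_matrix_def)
  have "index (g a \<otimes> x) = b \<longleftrightarrow> inv (g a) \<otimes> g b = x"
    using ab x inv_solve_left[of x "g a" "g b"] by (auto simp: index_eq_iff)
  with ab show "perm_matrix l (translation_perm x) $$ (a, b) =
      group_matrix G g l (\<lambda>y. if y = x then 1 else 0) $$ (a, b)"
    by (simp add: perm_matrix_def group_matrix_def translation_perm_def)
qed (simp_all add: perm_matrix_def group_matrix_def)

lemma point_matrix_eq:
  "r < l \<Longrightarrow> point_matrix G g l r = perm_matrix l (translation_perm (g r))"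
  by (simp add: point_matrix_def perm_matrix_translation_perm)

lemma point_matrices_eq:
  "point_matrix G g l ` {0..<l} = (perm_matrix l \<circ> translation_perm) ` carrier G"
proof -
  have "point_matrix G g l ` {0..<l} = (perm_matrix l \<circ> translation_perm) ` g ` {0..<l}"
    unfolding image_image by (rule image_cong) (simp_all add: point_matrix_eq)
  then show ?thesis using enum by (simp add: bij_betw_def)
qed

text \<open>Since \<open>point_perms\<close> is defined through matrices, injectivity of
  \<open>perm_matrix\<close> on \<open>Bij\<close> is what recovers the permutation from its
  matrix.\<close>

lemma point_perms_eq: "point_perms G g l = translation_perm ` carrier G"
proof -
  have "\<pi> \<in> translation_perm ` carrier G"
    if "\<pi> \<in> Bij {0..<l}" "perm_matrix l \<pi> = perm_matrix l (translation_perm x)" "x \<in> carrier G"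
    for \<pi> x
    using that perm_matrix_bij[of l] translation_perm_Bij[of x]
    by (auto simp: bij_betw_def dest: inj_onD)
  then show ?thesis
    by (auto simp: point_perms_def point_matrices_eq BijGroup_def translation_perm_Bij)
qed

lemma translation_matrix_inj: "inj_on (perm_matrix l \<circ> translation_perm) (carrier G)"
proof (rule comp_inj_on[OF translation_perm_inj])
  show "inj_on (perm_matrix l) (translation_perm ` carrier G)"
    using perm_matrix_bij[of l] translation_perm_Bij
    by (auto simp: bij_betw_def intro: inj_on_subset)
qed

lemma translation_matrix_hom: "perm_matrix l \<circ> translation_perm \<in> hom G (perm_matrix_group l)"
proof (rule homI)
  fix x y assume xy: "x \<in> carrier G" "y \<in> carrier G"
  then show "(perm_matrix l \<circ> translation_perm) (x \<otimes> y) =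
      (perm_matrix l \<circ> translation_perm) x \<otimes>\<^bsub>perm_matrix_group l\<^esub>
      (perm_matrix l \<circ> translation_perm) y"
    \<comment> \<open>\<open>perm_matrix\<close> reverses products, so the right-hand side becomes
      the matrix of the translation by \<open>y \<otimes> x\<close>; commutativity of
      \<open>G\<close> undoes the reversal.\<close>
    by (simp add: perm_matrix_group_def perm_matrix_mult translation_perm_Bij
        flip: translation_perm_mult) (simp add: m_comm)
qed (simp add: perm_matrix_group_def perm_matrices_def translation_perm_Bij)

text \<open>Ensures that the point matrices really are \<open>l\<close> different matrices.\<close>

lemma point_matrix_inj: "inj_on (point_matrix G g l) {0..<l}"
proof -
  have "inj_on ((perm_matrix l \<circ> translation_perm) \<circ> g) {0..<l}"
    using enum translation_matrix_inj by (auto simp: bij_betw_def intro: comp_inj_on)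
  then show ?thesis
    by (rule inj_on_cong[THEN iffD1, rotated]) (simp add: point_matrix_eq)
qed

text \<open>Every \<open>inv (g a) \<otimes> g b\<close> lies in the carrier, so the values of
  \<open>p\<close> elsewhere, which a distribution leaves arbitrary, never enter the matrix.\<close>

lemma group_matrix_cong:
  assumes "\<And>x. x \<in> carrier G \<Longrightarrow> p x = q x"
  shows "group_matrix G g l p = group_matrix G g l q"
  by (rule eq_matI) (auto simp: group_matrix_def assms)

text \<open>Along a row, and along a column, the argument of \<open>p\<close> runs through the
  carrier exactly once, so each sum is the total mass of \<open>p\<close>.\<close>

lemma doubly_stochastic_group_matrix:
  assumes p: "prob_distribution_on G p"
  shows "doubly_stochastic l (group_matrix G g l p)"
proof -
  have row: "(\<Sum>b=0..<l. p (inv (g a) \<otimes> g b)) = 1" if a: "a < l" for a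
  proof -
    have "(\<Sum>b=0..<l. p (inv (g a) \<otimes> g b)) = (\<Sum>x\<in>carrier G. p (inv (g a) \<otimes> x))"
      by (rule sum.reindex_bij_betw[OF enum])
    also have "\<dots> = (\<Sum>x\<in>carrier G. p x)"
      using a by (intro sum.reindex_bij_witness[where i = "\<lambda>x. g a \<otimes> x" and j = "\<lambda>x. inv (g a) \<otimes> x"])
        (auto simp: m_assoc[symmetric])
    finally show ?thesis using p by (simp add: prob_distribution_on_def)
  qed
  have col: "(\<Sum>a=0..<l. p (inv (g a) \<otimes> g b)) = 1" if b: "b < l" for b
  proof -
    have "(\<Sum>a=0..<l. p (inv (g a) \<otimes> g b)) = (\<Sum>x\<in>carrier G. p (inv x \<otimes> g b))"
      by (rule sum.reindex_bij_betw[OF enum])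
    also have "\<dots> = (\<Sum>x\<in>carrier G. p x)"
      \<comment> \<open>The witness \<open>i\<close> comes from solving
        \<open>inv x \<otimes> g b = y\<close> for \<open>x\<close>, namely
        \<open>x = g b \<otimes> inv y\<close>.\<close>
      using b by (intro sum.reindex_bij_witness[where i = "\<lambda>x. g b \<otimes> inv x" and j = "\<lambda>x. inv x \<otimes> g b"])
        (auto simp: inv_mult_group m_assoc m_assoc[symmetric])
    finally show ?thesis using p by (simp add: prob_distribution_on_def)
  qed
  show ?thesis
    using p row col by (simp add: doubly_stochastic_def group_matrix_def prob_distribution_on_def)
qed

text \<open>Injectivity of \<open>translation_perm\<close> turns the sum over permutations into one
  over the carrier, where only the term \<open>x = inv (g a) \<otimes> g b\<close> survives. Both
  inclusions below rest on this.\<close>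

lemma mixture_translation_matrices:
  "mat l l (\<lambda>(a, b). \<Sum>\<pi>\<in>translation_perm ` carrier G. c \<pi> * perm_matrix l \<pi> $$ (a, b)) =
   group_matrix G g l (\<lambda>x. c (translation_perm x))"
proof (rule eq_matI)
  fix a b
  assume "a < dim_row (group_matrix G g l (\<lambda>x. c (translation_perm x)))"
    and "b < dim_col (group_matrix G g l (\<lambda>x. c (translation_perm x)))"
  then have ab: "a < l" "b < l" by (simp_all add: group_matrix_def)
  have "(\<Sum>\<pi>\<in>translation_perm ` carrier G. c \<pi> * perm_matrix l \<pi> $$ (a, b)) =
      (\<Sum>x\<in>carrier G. c (translation_perm x) * perm_matrix l (translation_perm x) $$ (a, b))"
    by (simp add: sum.reindex[OF translation_perm_inj])
  also have "\<dots> = (\<Sum>x\<in>carrier G. if inv (g a) \<otimes> g b = x then c (translation_perm x) else 0)"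
    using ab by (intro sum.cong) (simp_all add: perm_matrix_translation_perm group_matrix_def)
  also have "\<dots> = c (translation_perm (inv (g a) \<otimes> g b))"
    using ab finite_carrier by simp
  finally show "mat l l (\<lambda>(a, b). \<Sum>\<pi>\<in>translation_perm ` carrier G.
        c \<pi> * perm_matrix l \<pi> $$ (a, b)) $$ (a, b) =
      group_matrix G g l (\<lambda>x. c (translation_perm x)) $$ (a, b)"
    using ab by (simp add: group_matrix_def)
qed (simp_all add: group_matrix_def)

lemma group_matrices_eq_birkhoff:
  "{group_matrix G g l p | p. prob_distribution_on G p} =
   birkhoff_subpolytope l (point_perms G g l)"
proof (intro equalityI subsetI)
  fix A assume "A \<in> {group_matrix G g l p | p. prob_distribution_on G p}"
  then obtain p where p: "prob_distribution_on G p" and A: "A = group_matrix G g l p" by blast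
  \<comment> \<open>The polytope indexes its coefficients by permutations, so \<open>p\<close> is
    transported along the inverse of \<open>translation_perm\<close>.\<close>
  define c where "c = p \<circ> inv_into (carrier G) translation_perm"
  have c: "c (translation_perm x) = p x" if "x \<in> carrier G" for x
    using that by (simp add: c_def inv_into_f_f[OF translation_perm_inj])
  have "A = group_matrix G g l (\<lambda>x. c (translation_perm x))"
    unfolding A by (rule group_matrix_cong) (simp add: c)
  moreover have "(\<Sum>\<pi>\<in>translation_perm ` carrier G. c \<pi>) = 1"
    using p by (simp add: sum.reindex[OF translation_perm_inj] c prob_distribution_on_def)
  moreover have "\<forall>\<pi>\<in>translation_perm ` carrier G. 0 \<le> c \<pi>"
    using p by (simp add: c prob_distribution_on_def)
  ultimately show "A \<in> birkhoff_subpolytope l (point_perms G g l)"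
    using doubly_stochastic_group_matrix[OF p]
    unfolding birkhoff_subpolytope_def point_perms_eq mem_Collect_eq mixture_translation_matrices
    by (auto simp: A)
next
  fix A assume "A \<in> birkhoff_subpolytope l (point_perms G g l)"
  then obtain c where c: "\<forall>\<pi>\<in>translation_perm ` carrier G. 0 \<le> c \<pi>"
      "(\<Sum>\<pi>\<in>translation_perm ` carrier G. c \<pi>) = 1"
    and A: "A = group_matrix G g l (\<lambda>x. c (translation_perm x))"
    unfolding birkhoff_subpolytope_def point_perms_eq mem_Collect_eq mixture_translation_matrices
    by blast
  \<comment> \<open>Conversely, convex coefficients pulled back to the group have the same signs and
    the same total.\<close>
  have "prob_distribution_on G (\<lambda>x. c (translation_perm x))"
    using c by (simp add: prob_distribution_on_def sum.reindex[OF translation_perm_inj])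
  with A show "A \<in> {group_matrix G g l p | p. prob_distribution_on G p}" by blast
qed

end

theorem propositionV1:
  fixes G :: "('a, 'b) monoid_scheme" and g :: "nat \<Rightarrow> 'a" and l :: nat
  assumes "comm_group G" and "finite (carrier G)"
    and "bij_betw g {0..<l} (carrier G)"
  shows
    "(\<forall>p. prob_distribution_on G p \<longrightarrow>
        (\<forall>a<l. group_matrix G g l p $$ (a, a) = p \<one>\<^bsub>G\<^esub>)) \<and>
     (\<forall>r<l. \<forall>p. prob_distribution_on G p \<and> p (g r) = 1 \<and> (\<forall>s<l. s \<noteq> r \<longrightarrow> p (g s) = 0) \<longrightarrow>
        group_matrix G g l p \<in> perm_matrices l \<and>
        group_matrix G g l p = point_matrix G g l r) \<and>
     (inj_on (point_matrix G g l) {0..<l} \<and>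
      subgroup (point_matrix G g l ` {0..<l}) (perm_matrix_group l) \<and>
      (perm_matrix_group l)\<lparr>carrier := point_matrix G g l ` {0..<l}\<rparr> \<cong> G \<and>
      subgroup (point_perms G g l) (BijGroup {0..<l}) \<and>
      (BijGroup {0..<l})\<lparr>carrier := point_perms G g l\<rparr> \<cong> G) \<and>
     {group_matrix G g l p | p. prob_distribution_on G p} =
       birkhoff_subpolytope l (point_perms G g l)"
proof -
  interpret enumerated_comm_group G g l
    using assms by (simp add: enumerated_comm_group_def enumerated_comm_group_axioms_def)
  have diagonal: "group_matrix G g l p $$ (a, a) = p \<one>\<^bsub>G\<^esub>" if "a < l" for p a
    using that by (simp add: group_matrix_def)
  have point: "group_matrix G g l p \<in> perm_matrices l \<and>
      group_matrix G g l p = point_matrix G g l r"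
    if r: "r < l" and p: "p (g r) = 1" "\<forall>s<l. s \<noteq> r \<longrightarrow> p (g s) = 0" for r p
  proof -
    \<comment> \<open>The assumptions on \<open>p\<close> are phrased by indices; writing
      \<open>x\<close> as \<open>g (index x)\<close> carries them over to the whole carrier.\<close>
    have "p x = (if x = g r then 1 else 0)" if "x \<in> carrier G" for x
      using that p by (metis enum_index index_less)
    then have "group_matrix G g l p = point_matrix G g l r"
      unfolding point_matrix_def by (rule group_matrix_cong)
    with r show ?thesis
      by (simp add: point_matrix_eq perm_matrices_def translation_perm_Bij)
  qed
  show ?thesis
    \<comment> \<open>The image lemma is instantiated for both groups, and \<open>folded\<close>
      rewrites the images of the carrier as the point matrices and as
      \<open>point_perms\<close>.\<close>
    using diagonal point point_matrix_inj group_matrices_eq_birkhoff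
      inj_hom_image_subgroup_iso[OF group_perm_matrix_group translation_matrix_hom
        translation_matrix_inj, folded point_matrices_eq]
      inj_hom_image_subgroup_iso[OF group_BijGroup translation_perm_hom
        translation_perm_inj, folded point_perms_eq]
    by (intro conjI) blast+
qed

end
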